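(* Let $s,k,n$ be integers and $m\ge 1$. Let $p,q,r,a,b,c$ be real numbers with $c\neq 0$, let $(P_n)_{n\in\mathbb{Z}}=\mathcal{P}(x)(p,q,r;a,b,c)$, $(U_n)_{n\in\mathbb{Z}}=\mathcal{P}(x)(0,0,1;a,b,c)$, and $\Delta_{\mathcal{P}}=(q^2-apq)x^2+(2qr-apr-bpq)x+(r^2-bpr-cp^2)$. Then \[ \det\Big(\Big[\frac{1}{P_{s+k(n+i+j)}}\Big]_{0\le i,j\le m}\Big) = \frac{(-1)^{(s+kn)\binom{m+1}{2}}\,c^{(s+kn)\binom{m+1}{2}+2k\binom{m+1}{3}}\,\Delta_{\mathcal{P}}^{\binom{m+1}{2}}\prod_{i=0}^m U_{k(i+1)}^{2(m-i)}}{\prod_{0\le i,j\le m}P_{s+k(n+i+j)}}, \] provided that the denominators on both sides of the identity are nonzero.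
   Context: For real numbers $p,q,r,a,b,c$ with $c\neq 0$, $\mathcal{P}(x)(p,q,r;a,b,c)=(P_n)_{n\in\mathbb{Z}}$ denotes the sequence of polynomials in $x$ defined by $P_0=p$, $P_1=qx+r$, $P_{n+2}=(ax+b)P_{n+1}+cP_n$ for $n\ge 0$, and for $n<0$ by $P_n=-\frac{ax+b}{c}P_{n+1}+\frac{1}{c}P_{n+2}$; so $U_0=0$, $U_1=1$. $[M_{i,j}]_{0\le i,j\le m}$ is the $(m+1)\times(m+1)$ matrix with entry $M_{i,j}$ in row $i$, column $j$. *)

theory Defs
  imports
    "HOL-Computational_Algebra.Polynomial_Factorial"
    "Jordan_Normal_Form.Determinant"
begin

text \<open>Coefficients are listed in ascending order: \<open>[:r, q:]\<close> is $qx+r$, \<open>[:b, a:]\<close> is $ax+b$.\<close>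

function poly_seq :: "real \<Rightarrow> real \<Rightarrow> real \<Rightarrow> real \<Rightarrow> real \<Rightarrow> real \<Rightarrow> int \<Rightarrow> real poly" where
  "poly_seq p q r a b c n =
    (if n = 0 then [:p:]
     else if n = 1 then [:r, q:]
     else if n \<ge> 2 then
       [:b, a:] * poly_seq p q r a b c (n - 1) + smult c (poly_seq p q r a b c (n - 2))
     else
       - smult (1 / c) [:b, a:] * poly_seq p q r a b c (n + 1)
         + smult (1 / c) (poly_seq p q r a b c (n + 2)))"
  by pat_completeness auto
termination
  by (relation "Wellfounded.measure (\<lambda>(p, q, r, a, b, c, n). nat (if n \<ge> 0 then n else 1 - n))") auto

declare poly_seq.simps [simp del]

lemma poly_seq_0: "poly_seq p q r a b c 0 = [:p:]"
  by (simp add: poly_seq.simps)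

lemma poly_seq_1: "poly_seq p q r a b c 1 = [:r, q:]"
  by (simp add: poly_seq.simps)

lemma poly_seq_nonneg:
  assumes "n \<ge> 0"
  shows "poly_seq p q r a b c (n + 2) =
    [:b, a:] * poly_seq p q r a b c (n + 1) + smult c (poly_seq p q r a b c n)"
  using assms by (subst poly_seq.simps) (simp add: add.commute)

lemma poly_seq_neg:
  assumes "n < 0"
  shows "poly_seq p q r a b c n =
    - smult (1 / c) [:b, a:] * poly_seq p q r a b c (n + 1)
      + smult (1 / c) (poly_seq p q r a b c (n + 2))"
  using assms by (subst poly_seq.simps) simp

definition poly_seq_Delta :: "real \<Rightarrow> real \<Rightarrow> real \<Rightarrow> real \<Rightarrow> real \<Rightarrow> real \<Rightarrow> real poly" where
  "poly_seq_Delta p q r a b c =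
    [: r\<^sup>2 - b * p * r - c * p\<^sup>2, 2 * q * r - a * p * r - b * p * q, q\<^sup>2 - a * p * q :]"

end

theory Submission
  imports Defs
begin

text \<open>
  Every \<open>2 \<times> 2\<close> minor of the Hankel matrix with entries \<open>P (s + k (n + i + j))\<close> splits into a factor
  depending on the rows and a factor depending on the columns: this is the Catalan-type identity
  \<open>P\<^bsub>A+u\<^esub> P\<^bsub>A+v\<^esub> - P\<^bsub>A\<^esub> P\<^bsub>A+u+v\<^esub> = (-c)\<^bsup>A\<^esup> \<Delta> U\<^bsub>u\<^esub> U\<^bsub>v\<^esub>\<close>. For such a matrix the Schur complement of the
  top left entry of the matrix of reciprocals is, up to scaling rows and columns, again a matrix of
  reciprocals of the same kind, so its determinant has a Cauchy-type product formula.
\<close>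

section \<open>A Cauchy-type determinant\<close>

text \<open>In the Leibniz expansion, the term of a permutation meets each row and each column
  exactly once, so it picks up every \<open>f i\<close> and every \<open>g j\<close> once.\<close>

lemma det_scale_rows_cols:
  fixes h :: "nat \<Rightarrow> nat \<Rightarrow> 'a :: comm_ring_1"
  shows "det (mat n n (\<lambda>(i, j). f i * g j * h i j)) =
    (\<Prod>i<n. f i) * (\<Prod>j<n. g j) * det (mat n n (\<lambda>(i, j). h i j))"
proof -
  have "signof \<pi> * (\<Prod>i=0..<n. mat n n (\<lambda>(i, j). f i * g j * h i j) $$ (i, \<pi> i)) =
      (\<Prod>i<n. f i) * (\<Prod>j<n. g j) * (signof \<pi> * (\<Prod>i=0..<n. mat n n (\<lambda>(i, j). h i j) $$ (i, \<pi> i)))"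
    if \<pi>: "\<pi> permutes {0..<n}" for \<pi>
  proof -
    have "(\<Prod>i=0..<n. mat n n (\<lambda>(i, j). f i * g j * h i j) $$ (i, \<pi> i)) =
        (\<Prod>i=0..<n. f i * g (\<pi> i) * mat n n (\<lambda>(i, j). h i j) $$ (i, \<pi> i))"
      using permutes_in_image[OF \<pi>] by (intro prod.cong) auto
    moreover have "(\<Prod>i=0..<n. g (\<pi> i)) = (\<Prod>j<n. g j)"
      using prod.permute[OF \<pi>, of g] by (simp add: o_def atLeast0LessThan)
    ultimately show ?thesis
      by (simp add: prod.distrib atLeast0LessThan mult_ac)
  qed
  then show ?thesis
    by (simp add: det_def'[of _ n] sum_distrib_left)
qed

text \<open>Gaussian elimination of the first column in block form: the matrix factors as
  \<open>L * R\<close>, with \<open>L\<close> unit lower triangular and \<open>R\<close> block upper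
  triangular with diagonal blocks \<open>A 0 0\<close> and the Schur complement
  \<open>S\<close>.\<close>

lemma det_Schur_complement:
  fixes A :: "nat \<Rightarrow> nat \<Rightarrow> 'a :: field"
  assumes "A 0 0 \<noteq> 0"
  shows "det (mat (Suc n) (Suc n) (\<lambda>(i, j). A i j)) =
    A 0 0 * det (mat n n (\<lambda>(i, j). A (Suc i) (Suc j) - A (Suc i) 0 * A 0 (Suc j) / A 0 0))"
proof -
  define S where "S = mat n n (\<lambda>(i, j). A (Suc i) (Suc j) - A (Suc i) 0 * A 0 (Suc j) / A 0 0)"
  define L where "L = four_block_mat (1\<^sub>m 1) (0\<^sub>m 1 n) (mat n 1 (\<lambda>(i, j). A (Suc i) 0 / A 0 0)) (1\<^sub>m n)"
  define R where "R = four_block_mat (mat 1 1 (\<lambda>_. A 0 0)) (mat 1 n (\<lambda>(i, j). A 0 (Suc j))) (0\<^sub>m n 1) S"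
  have S: "S \<in> carrier_mat n n"
    by (simp add: S_def)
  have LR: "L \<in> carrier_mat (Suc n) (Suc n)" "R \<in> carrier_mat (Suc n) (Suc n)"
    by (auto simp: L_def R_def S_def)
  have "mat (Suc n) (Suc n) (\<lambda>(i, j). A i j) = L * R"
    unfolding L_def R_def
    by (subst mult_four_block_mat[of _ 1 1 _ n _ n _ _ 1 _ n])
      (use assms in \<open>auto simp: S_def scalar_prod_def intro!: eq_matI\<close>)
  moreover have "det L = 1"
    unfolding L_def by (subst det_four_block_mat_upper_right_zero[of _ 1 _ n]) auto
  moreover have "det R = A 0 0 * det S"
    unfolding R_def
    by (subst det_four_block_mat_lower_left_zero[of _ 1 _ n]) (auto simp: S det_single)
  ultimately show ?thesis
    using det_mult[OF LR] by (simp add: S_def)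
qed

text \<open>Cauchy's determinant is the case \<open>D i j = x i + y j\<close>, where
  \<open>X i i' = x i' - x i\<close> and \<open>V j j' = y j' - y j\<close>. The induction removes
  row and column 0; the remaining entries \<open>D (Suc i) (Suc j)\<close> satisfy the same minor
  condition with shifted \<open>X\<close> and \<open>V\<close>.\<close>

theorem det_reciprocals_of_factoring_minors:
  fixes D X V :: "nat \<Rightarrow> nat \<Rightarrow> 'a :: field"
  assumes "\<And>i j. i < n \<Longrightarrow> j < n \<Longrightarrow> D i j \<noteq> 0"
    and "\<And>i i' j j'. i < i' \<Longrightarrow> i' < n \<Longrightarrow> j < j' \<Longrightarrow> j' < n \<Longrightarrow>
      D i j' * D i' j - D i j * D i' j' = X i i' * V j j'"
  shows "det (mat n n (\<lambda>(i, j). 1 / D i j)) =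
    (\<Prod>j<n. \<Prod>i<j. X i j * V i j) / (\<Prod>i<n. \<Prod>j<n. D i j)"
  using assms
proof (induction n arbitrary: D X V)
  case 0
  then show ?case by simp
next
  case (Suc n)
  have nz: "D i j \<noteq> 0" if "i \<le> n" "j \<le> n" for i j
    using Suc.prems(1) that by simp
  have minor: "D 0 (Suc j) * D (Suc i) 0 - D 0 0 * D (Suc i) (Suc j) = X 0 (Suc i) * V 0 (Suc j)"
    if "i < n" "j < n" for i j
    using Suc.prems(2)[of 0 "Suc i" 0 "Suc j"] that by simp
  \<comment> \<open>Over the common denominator, the numerator of the left side is the minor on rows
    \<open>0, Suc i\<close> and columns \<open>0, Suc j\<close>.\<close>
  have schur: "1 / D (Suc i) (Suc j) - 1 / D (Suc i) 0 * (1 / D 0 (Suc j)) / (1 / D 0 0) =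
      (X 0 (Suc i) / D (Suc i) 0) * (V 0 (Suc j) / D 0 (Suc j)) * (1 / D (Suc i) (Suc j))"
    if "i < n" "j < n" for i j
    using minor[OF that, symmetric] that nz[of 0 0] nz[of "Suc i" 0] nz[of 0 "Suc j"] nz[of "Suc i" "Suc j"]
    by (simp add: field_simps)
  have "det (mat (Suc n) (Suc n) (\<lambda>(i, j). 1 / D i j)) = 1 / D 0 0 *
      det (mat n n (\<lambda>(i, j). 1 / D (Suc i) (Suc j) - 1 / D (Suc i) 0 * (1 / D 0 (Suc j)) / (1 / D 0 0)))"
    using nz[of 0 0] by (intro det_Schur_complement) simp
  also have "mat n n (\<lambda>(i, j). 1 / D (Suc i) (Suc j) - 1 / D (Suc i) 0 * (1 / D 0 (Suc j)) / (1 / D 0 0)) =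
      mat n n (\<lambda>(i, j). (X 0 (Suc i) / D (Suc i) 0) * (V 0 (Suc j) / D 0 (Suc j)) * (1 / D (Suc i) (Suc j)))"
    by (rule eq_matI) (use schur in \<open>auto\<close>)
  also have "det \<dots> = (\<Prod>i<n. X 0 (Suc i) / D (Suc i) 0) * (\<Prod>j<n. V 0 (Suc j) / D 0 (Suc j)) *
      det (mat n n (\<lambda>(i, j). 1 / D (Suc i) (Suc j)))"
    by (rule det_scale_rows_cols)
  also have "det (mat n n (\<lambda>(i, j). 1 / D (Suc i) (Suc j))) =
      (\<Prod>j<n. \<Prod>i<j. X (Suc i) (Suc j) * V (Suc i) (Suc j)) / (\<Prod>i<n. \<Prod>j<n. D (Suc i) (Suc j))"
    using Suc.prems by (intro Suc.IH) auto
  \<comment> \<open>Splitting products at index 0 matches the factors: \<open>X 0 (Suc i)\<close>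
    and \<open>V 0 (Suc j)\<close> supply the pairs starting at 0, and the scaling denominators with
    \<open>D 0 0\<close> supply row and column 0.\<close>
  finally show ?case
    by (simp add: prod.lessThan_Suc_shift prod.distrib prod_dividef mult_ac del: prod.lessThan_Suc)
qed

section \<open>Two-sided linear recurrences\<close>

lemma smult_left_cancel: "c \<noteq> 0 \<Longrightarrow> smult c x = smult c y \<longleftrightarrow> x = y" for c :: "'a :: idom"
  using smult_eq_0_iff[of c "x - y"] by (simp add: smult_diff_right)

text \<open>Two consecutive values determine the sequence in both directions; going down requires
  cancelling \<open>c\<close>.\<close>

lemma two_sided_recurrence_unique:
  fixes f g :: "int \<Rightarrow> real poly"
  assumes "c \<noteq> 0"
    and f: "\<And>n. f (n + 2) = w * f (n + 1) + smult c (f n)"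
    and g: "\<And>n. g (n + 2) = w * g (n + 1) + smult c (g n)"
    and "f 0 = g 0" "f 1 = g 1"
  shows "f n = g n"
proof -
  have "f n = g n \<and> f (n + 1) = g (n + 1)"
  proof (induction n rule: int_induct[of _ 0])
    case base
    then show ?case using assms by simp
  next
    case (step1 i)
    then show ?case using f[of i] g[of i] by (simp add: add.assoc)
  next
    case (step2 i)
    have "smult c (f (i - 1)) = smult c (g (i - 1))"
      using f[of "i - 1"] g[of "i - 1"] step2 by (simp add: algebra_simps)
    then have "f (i - 1) = g (i - 1)"
      using \<open>c \<noteq> 0\<close> by (simp add: smult_left_cancel)
    then show ?case using step2 by simp
  qed
  then show ?thesis ..
qed

text \<open>Multiplying the defining equation for negative indices by \<open>c\<close> gives back
  the forward recurrence, so later arguments need no sign split on the index.\<close>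

lemma poly_seq_recurrence:
  assumes "c \<noteq> 0"
  shows "poly_seq p q r a b c (n + 2) =
    [:b, a:] * poly_seq p q r a b c (n + 1) + smult c (poly_seq p q r a b c n)"
proof (cases "n \<ge> 0")
  case True
  then show ?thesis by (rule poly_seq_nonneg)
next
  case False
  have "smult c (- smult (1 / c) w * x + smult (1 / c) y) = - (w * x) + y" for w x y :: "real poly"
    using assms by (simp add: smult_diff_right)
  with False have "smult c (poly_seq p q r a b c n) =
      - ([:b, a:] * poly_seq p q r a b c (n + 1)) + poly_seq p q r a b c (n + 2)"
    by (simp only: poly_seq_neg not_le)
  then show ?thesis by simp
qed

context
  fixes p q r a b c :: real and P U :: "int \<Rightarrow> real poly" and \<Delta> :: "real poly"
  assumes c: "c \<noteq> 0"
  defines "P \<equiv> poly_seq p q r a b c"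
    and "U \<equiv> poly_seq 0 0 1 a b c"
    and "\<Delta> \<equiv> poly_seq_Delta p q r a b c"
begin

lemma P_recurrence: "P (n + 2) = [:b, a:] * P (n + 1) + smult c (P n)"
  unfolding P_def using c by (rule poly_seq_recurrence)

lemma U_recurrence: "U (n + 2) = [:b, a:] * U (n + 1) + smult c (U n)"
  unfolding U_def using c by (rule poly_seq_recurrence)

text \<open>The left side is multiplied by \<open>-c\<close> when \<open>A\<close> grows by 1, and
  at \<open>A = 0\<close> it expands to the coefficients of \<open>poly_seq_Delta\<close>.\<close>

lemma poly_seq_Cassini: "P (A + 1) ^ 2 - P A * P (A + 2) = smult ((-c) powi A) \<Delta>"
proof -
  have step: "P (A + 2) ^ 2 - P (A + 1) * P (A + 3) = smult (-c) (P (A + 1) ^ 2 - P A * P (A + 2))" for A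
  proof -
    have 3: "P (A + 3) = [:b, a:] * P (A + 2) + smult c (P (A + 1))"
      using P_recurrence[of "A + 1"] by (simp add: add.assoc)
    have "(w * y + smult c x)\<^sup>2 - y * (w * (w * y + smult c x) + smult c y) =
        smult (-c) (y\<^sup>2 - x * (w * y + smult c x))" for w x y :: "real poly"
      by (simp add: algebra_simps power2_eq_square smult_add_right smult_diff_right)
    then show ?thesis
      by (simp only: 3 P_recurrence[of A])
  qed
  show ?thesis
  proof (induction A rule: int_induct[of _ 0])
    case base
    have "P 2 = [:b, a:] * P 1 + smult c (P 0)"
      using P_recurrence[of 0] by simp
    then show ?case
      by (simp add: P_def poly_seq_0 poly_seq_1 \<Delta>_def poly_seq_Delta_def algebra_simps power2_eq_square)
  next
    case (step1 i)
    then show ?case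
      using step[of i] c by (simp add: power_int_add add.assoc mult.commute)
  next
    case (step2 i)
    have "smult (-c) (P i ^ 2 - P (i - 1) * P (i + 1)) = smult (-c) (smult ((-c) powi (i - 1)) \<Delta>)"
      using step[of "i - 1"] step2 c by (simp add: power_int_diff add.commute)
    then have "P i ^ 2 - P (i - 1) * P (i + 1) = smult ((-c) powi (i - 1)) \<Delta>"
      using c by (subst (asm) smult_left_cancel) simp_all
    then show ?case by (simp add: add.commute)
  qed
qed

text \<open>For fixed \<open>A\<close> and \<open>v\<close>, both sides solve the same recurrence in
  \<open>u\<close>, so it suffices to compare them at \<open>u = 0\<close>, where both vanish, and
  at \<open>u = 1\<close>.\<close>

lemma poly_seq_Catalan:
  "P (A + u) * P (A + v) - P A * P (A + u + v) = smult ((-c) powi A) (\<Delta> * U u * U v)"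
proof -
  have U01: "U 0 = 0" "U 1 = 1"
    by (simp_all add: U_def poly_seq_0 poly_seq_1 one_pCons)
  have lin: "\<alpha> * (w * x + smult c y) - \<beta> * (w * z + smult c t) =
      w * (\<alpha> * x - \<beta> * z) + smult c (\<alpha> * y - \<beta> * t)" for \<alpha> \<beta> w x y z t :: "real poly"
    by (simp add: algebra_simps smult_diff_right)
  \<comment> \<open>The case \<open>u = 1\<close> is again settled by uniqueness, now in
    \<open>v\<close>: both sides vanish at \<open>v = 0\<close>, and \<open>v = 1\<close> is the
    Cassini identity.\<close>
  have one: "P (A + 1) * P (A + v) - P A * P (A + 1 + v) = smult ((-c) powi A) (\<Delta> * U v)" for v
  proof (rule two_sided_recurrence_unique[OF c, where w = "[:b, a:]"])
    show "P (A + 1) * P (A + (n + 2)) - P A * P (A + 1 + (n + 2)) =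
        [:b, a:] * (P (A + 1) * P (A + (n + 1)) - P A * P (A + 1 + (n + 1))) +
        smult c (P (A + 1) * P (A + n) - P A * P (A + 1 + n))" for n
      using P_recurrence[of "A + n"] P_recurrence[of "A + 1 + n"] lin by (simp only: add.assoc)
    show "smult ((-c) powi A) (\<Delta> * U (n + 2)) = [:b, a:] * smult ((-c) powi A) (\<Delta> * U (n + 1)) +
        smult c (smult ((-c) powi A) (\<Delta> * U n))" for n
      unfolding U_recurrence by (simp add: algebra_simps smult_add_right)
  qed (use poly_seq_Cassini[of A] in \<open>simp_all add: U01 power2_eq_square add.assoc\<close>)
  show ?thesis
  proof (rule two_sided_recurrence_unique[OF c, where w = "[:b, a:]" and n = u])
    have rec: "P (A + v) * P (A + n + 2) - P A * P (A + v + n + 2) =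
        [:b, a:] * (P (A + v) * P (A + n + 1) - P A * P (A + v + n + 1)) +
        smult c (P (A + v) * P (A + n) - P A * P (A + v + n))" for n
      by (simp only: P_recurrence[of "A + n"] P_recurrence[of "A + v + n"] lin)
    show "P (A + (n + 2)) * P (A + v) - P A * P (A + (n + 2) + v) =
        [:b, a:] * (P (A + (n + 1)) * P (A + v) - P A * P (A + (n + 1) + v)) +
        smult c (P (A + n) * P (A + v) - P A * P (A + n + v))" for n
      using rec[of n] by (simp only: ac_simps)
    show "smult ((-c) powi A) (\<Delta> * U (n + 2) * U v) = [:b, a:] * smult ((-c) powi A) (\<Delta> * U (n + 1) * U v) +
        smult c (smult ((-c) powi A) (\<Delta> * U n * U v))" for n
      unfolding U_recurrence by (simp add: algebra_simps smult_add_right)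
  qed (use one[of v] in \<open>simp_all add: U01\<close>)
qed

end

section \<open>Products over index pairs\<close>

text \<open>Among the pairs \<open>i < j \<le> m\<close>, the difference \<open>Suc d\<close> occurs
  exactly \<open>m - d\<close> times.\<close>

lemma prod_pairs_diff:
  fixes g :: "nat \<Rightarrow> 'a :: comm_monoid_mult"
  shows "(\<Prod>j<Suc m. \<Prod>i<j. g (j - i)) = (\<Prod>i=0..m. g (Suc i) ^ (m - i))"
proof (induction m)
  case 0
  then show ?case by simp
next
  case (Suc m)
  have "(\<Prod>i<Suc m. g (Suc m - i)) = (\<Prod>i=0..m. g (Suc i))"
    by (subst prod.nat_diff_reindex[symmetric]) (auto simp: atLeast0AtMost lessThan_Suc_atMost intro!: prod.cong)
  moreover have "(\<Prod>i=0..m. g (Suc i) ^ (Suc m - i)) = (\<Prod>i=0..m. g (Suc i) ^ (m - i) * g (Suc i))"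
    by (rule prod.cong) (auto simp: Suc_diff_le mult.commute)
  ultimately show ?case
    using Suc by (simp add: prod.distrib)
qed

text \<open>There are \<open>l choose 2\<close> pairs \<open>i < j < l\<close>. Summing
  \<open>i\<close> over them gives \<open>j choose 2\<close> for each \<open>j\<close>, hence
  \<open>l choose 3\<close> in total.\<close>

lemma prod_pairs_power_int:
  fixes d :: "'a :: field"
  assumes "d \<noteq> 0"
  shows "(\<Prod>j<l. \<Prod>i<j. d powi (N + 2 * k * int i)) = d powi (N * int (l choose 2) + 2 * k * int (l choose 3))"
proof (induction l)
  case 0
  then show ?case by (simp add: binomial_eq_0)
next
  case (Suc l)
  have "(\<Prod>i<l. d powi (N + 2 * k * int i)) = d powi (N * int l + 2 * k * int (l choose 2))" for l
  proof (induction l)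
    case (Suc l)
    have "Suc l choose 2 = l + (l choose 2)"
      by (simp add: numeral_2_eq_2)
    with Suc assms show ?case
      by (simp flip: power_int_add) (simp add: algebra_simps)
  qed (simp add: binomial_eq_0)
  moreover have "Suc l choose 2 = l + (l choose 2)" "Suc l choose 3 = (l choose 2) + (l choose 3)"
    by (simp_all add: numeral_2_eq_2 numeral_3_eq_3)
  ultimately show ?case
    using Suc assms by (simp flip: power_int_add) (simp add: algebra_simps)
qed

lemma prod_smult: "(\<Prod>i\<in>A. smult (f i) (g i)) = smult (\<Prod>i\<in>A. f i) (\<Prod>i\<in>A. g i)"
  by (induction A rule: infinite_finite_induct) (simp_all add: mult_ac)

lemma prod_pairs_const: "(\<Prod>j<l. \<Prod>i<j. x) = x ^ (l choose 2)"
  by (induction l) (simp_all add: numeral_2_eq_2 power_add mult_ac)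

lemma to_fract_prod: "to_fract (\<Prod>i\<in>A. f i) = (\<Prod>i\<in>A. to_fract (f i))"
  by (induction A rule: infinite_finite_induct) simp_all

text \<open>Reciprocals of polynomials live in the fraction field, hence \<open>to_fract\<close>; a
  nonzero denominator means a nonzero polynomial, not the absence of real roots.\<close>

theorem theorem4:
  fixes s k n :: int and m :: nat and p q r a b c :: real
    and P U :: "int \<Rightarrow> real poly" and \<Delta> :: "real poly"
  assumes "m \<ge> 1" and "c \<noteq> 0"
    and "P = poly_seq p q r a b c"
    and "U = poly_seq 0 0 1 a b c"
    and "\<Delta> = poly_seq_Delta p q r a b c"
    and "\<And>i j. i \<le> m \<Longrightarrow> j \<le> m \<Longrightarrow> P (s + k * (n + int i + int j)) \<noteq> 0"
  shows "det (mat (m + 1) (m + 1) (\<lambda>(i, j). 1 / to_fract (P (s + k * (n + int i + int j))))) =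
    to_fract (smult ((-1) powi ((s + k * n) * int ((m + 1) choose 2))
                     * c powi ((s + k * n) * int ((m + 1) choose 2) + 2 * k * int ((m + 1) choose 3)))
                (\<Delta> ^ ((m + 1) choose 2) * (\<Prod>i=0..m. U (k * (int i + 1)) ^ (2 * (m - i)))))
    / to_fract (\<Prod>i=0..m. \<Prod>j=0..m. P (s + k * (n + int i + int j)))"
proof -
  define N where "N = s + k * n"
  \<comment> \<open>The exponent \<open>N + k * int i + k * int j\<close> of \<open>-c\<close> in
    the Catalan identity is shared out: \<open>N + k * int i\<close> and \<open>\<Delta>\<close> go
    to the row factor, \<open>k * int j\<close> to the column factor.\<close>
  define X where "X i j = smult ((-c) powi (N + k * int i)) (\<Delta> * U (k * int (j - i)))" for i j
  define V where "V i j = smult ((-c) powi (k * int i)) (U (k * int (j - i)))" for i j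
  have minor: "P (s + k * (n + int i + int j')) * P (s + k * (n + int i' + int j)) -
      P (s + k * (n + int i + int j)) * P (s + k * (n + int i' + int j')) = X i i' * V j j'"
    if "i < i'" "j < j'" for i i' j j'
  proof -
    \<comment> \<open>The index of the top left entry of the minor; the other three entries are
      shifts of it by \<open>u\<close>, \<open>v\<close> and \<open>u + v\<close> as in the Catalan
      identity.\<close>
    define A where "A = s + k * (n + int i + int j)"
    have "s + k * (n + int i + int j') = A + k * int (j' - j)"
      "s + k * (n + int i' + int j) = A + k * int (i' - i)"
      "s + k * (n + int i' + int j') = A + k * int (j' - j) + k * int (i' - i)"
      using that by (simp_all add: A_def of_nat_diff algebra_simps)
    moreover have "(-c) powi A = (-c) powi (N + k * int i) * (-c) powi (k * int j)"
      using \<open>c \<noteq> 0\<close> by (simp add: A_def N_def algebra_simps flip: power_int_add)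
    ultimately show ?thesis
      using poly_seq_Catalan[OF \<open>c \<noteq> 0\<close>, of p q r a b A "k * int (j' - j)" "k * int (i' - i)"]
      by (simp add: assms(3-5) X_def V_def A_def[symmetric] mult_ac)
  qed
  have "X i j * V i j = smult ((-c) powi (N + 2 * k * int i)) (\<Delta> * U (k * int (j - i)) ^ 2)" for i j
    using \<open>c \<noteq> 0\<close> by (simp add: X_def V_def power2_eq_square mult_ac flip: power_int_add) (simp add: algebra_simps)
  then have "(\<Prod>j<Suc m. \<Prod>i<j. X i j * V i j) =
      smult (\<Prod>j<Suc m. \<Prod>i<j. (-c) powi (N + 2 * k * int i))
        ((\<Prod>j<Suc m. \<Prod>i<j. \<Delta>) * (\<Prod>j<Suc m. \<Prod>i<j. U (k * int (j - i)) ^ 2))"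
    by (simp only: prod_smult prod.distrib)
  also have "(\<Prod>j<Suc m. \<Prod>i<j. U (k * int (j - i)) ^ 2) = (\<Prod>i=0..m. U (k * (int i + 1)) ^ (2 * (m - i)))"
    using prod_pairs_diff[of "\<lambda>d. U (k * int d) ^ 2" m] by (simp add: power_mult add.commute)
  also have "(\<Prod>j<Suc m. \<Prod>i<j. (-c) powi (N + 2 * k * int i)) =
      (-c) powi (N * int (Suc m choose 2) + 2 * k * int (Suc m choose 3))"
    using \<open>c \<noteq> 0\<close> by (intro prod_pairs_power_int) simp
  also have "\<dots> = (-1) powi (N * int (Suc m choose 2)) * c powi (N * int (Suc m choose 2) + 2 * k * int (Suc m choose 3))"
  proof -
    \<comment> \<open>The binomial of order 3 enters the exponent with an even coefficient, so it
      leaves no trace in the sign.\<close>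
    have "(-1 :: real) powi (x + 2 * k * y) = (-1) powi x" for x y
      by (simp add: power_int_add power_int_mult)
    then show ?thesis
      using power_int_mult_distrib[of "-1" c] by (metis mult_minus1)
  qed
  finally have num: "(\<Prod>j<Suc m. \<Prod>i<j. X i j * V i j) =
      smult ((-1) powi (N * int (Suc m choose 2)) * c powi (N * int (Suc m choose 2) + 2 * k * int (Suc m choose 3)))
        (\<Delta> ^ (Suc m choose 2) * (\<Prod>i=0..m. U (k * (int i + 1)) ^ (2 * (m - i))))"
    by (simp only: prod_pairs_const)
  have "det (mat (Suc m) (Suc m) (\<lambda>(i, j). 1 / to_fract (P (s + k * (n + int i + int j))))) =
      (\<Prod>j<Suc m. \<Prod>i<j. to_fract (X i j) * to_fract (V i j)) /
      (\<Prod>i<Suc m. \<Prod>j<Suc m. to_fract (P (s + k * (n + int i + int j))))"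
    \<comment> \<open>Since \<open>to_fract\<close> respects products and differences, the
      factorisation of the minors carries over to the fraction field.\<close>
    using assms(6) minor
    by (intro det_reciprocals_of_factoring_minors) (simp_all flip: to_fract_mult to_fract_diff)
  also have "\<dots> = to_fract (\<Prod>j<Suc m. \<Prod>i<j. X i j * V i j) /
      to_fract (\<Prod>i=0..m. \<Prod>j=0..m. P (s + k * (n + int i + int j)))"
    by (simp only: to_fract_prod to_fract_mult atLeast0AtMost lessThan_Suc_atMost)
  finally show ?thesis
    unfolding num unfolding N_def Suc_eq_plus1 .
qed

end
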